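(* Let $N=3$, $\alpha_3=\frac{2\pi}{5}$ and $\lambda_3=\frac{9}{10}\sin\frac{\alpha_3}{16}\cos\frac{11\alpha_3}{16}$. Suppose $$mK\le\frac{\alpha_3}{4\Big(\sin\frac{\alpha_3}{16}\cos\frac{11\alpha_3}{16}+2\Big)\ln\Bigg(\dfrac{4\sin\frac{\alpha_3}{16}\cos\frac{11\alpha_3}{16}+6}{\sin\frac{\alpha_3}{16}\cos\frac{11\alpha_3}{16}}\Bigg)}\qquad\text{and}\qquad D(\Omega)<\lambda_3K.$$ Then for any initial phase $\Theta(0)\in\mathbb{R}^3$ and any initial velocity $\dot\Theta(0)\in\mathbb{R}^3$, the initial value problem for $$m\ddot\theta_i+\dot\theta_i=\omega_i+\frac{K}{3}\sum_{j=1}^3\sin(\theta_j-\theta_i),\qquad t>0,\ i=1,2,3,$$ admits a unique solution $\Theta=(\theta_1,\theta_2,\theta_3)\in C^\infty([0,\infty))$, and it satisfies $$\lim_{t\to\infty}\dot\theta_i(t)=\omega\quad\text{for all }1\le i\le3.$$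
   Context: $m>0$ is the inertia, $K>0$ is the coupling strength, and $\Omega=(\omega_1,\omega_2,\omega_3)\in\mathbb{R}^3$ is the constant vector of natural frequencies, with mean $\omega:=\frac13(\omega_1+\omega_2+\omega_3)$. The phases $\theta_i(t)$ are real-valued. For a finite-dimensional vector $X=(x_1,\dots,x_n)$, $D(X):=\max_{1\le i,j\le n}(x_i-x_j)$. *)

theory Defs
  imports "HOL-Analysis.Analysis"
begin

definition diam :: "real ^ 'n \<Rightarrow> real" where
  "diam X = Max {X $ i - X $ j | i j. True}"

definition mean_freq :: "real ^ 3 \<Rightarrow> real" where
  "mean_freq \<Omega> = (1 / 3) * (\<Omega> $ 1 + \<Omega> $ 2 + \<Omega> $ 3)"

definition alpha3 :: real where
  "alpha3 = 2 * pi / 5"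

definition lambda3 :: real where
  "lambda3 = 9 / 10 * sin (alpha3 / 16) * cos (11 * alpha3 / 16)"

(* Only the values of f on the half-line matter; derivatives at 0 are one-sided. *)
definition smooth_on_half_line :: "(real \<Rightarrow> 'a::real_normed_vector) \<Rightarrow> bool" where
  "smooth_on_half_line f \<longleftrightarrow>
     (\<exists>d :: nat \<Rightarrow> real \<Rightarrow> 'a.
        (\<forall>t\<ge>0. d 0 t = f t) \<and>
        (\<forall>k. \<forall>t\<ge>0. (d k has_vector_derivative d (Suc k) t) (at t within {0..})))"

(* Classical solutions: C^1 up to t = 0, which gives the initial velocity its meaning
   (a one-sided derivative), and twice differentiable for t > 0, where the equation holds. *)
definition kuramoto_ivp_solution ::
  "real \<Rightarrow> real \<Rightarrow> real ^ 3 \<Rightarrow> real ^ 3 \<Rightarrow> real ^ 3 \<Rightarrow> (real \<Rightarrow> real ^ 3) \<Rightarrow> bool" where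
  "kuramoto_ivp_solution m K \<Omega> \<Theta>0 V0 \<theta> \<longleftrightarrow>
     (\<exists>v :: real \<Rightarrow> real ^ 3.
        (\<forall>t\<ge>0. (\<theta> has_vector_derivative v t) (at t within {0..})) \<and>
        continuous_on {0..} v \<and>
        \<theta> 0 = \<Theta>0 \<and> v 0 = V0 \<and>
        (\<forall>t>0. \<exists>a :: real ^ 3. (v has_vector_derivative a) (at t) \<and>
           (\<forall>i. m * a $ i + v t $ i =
                 \<Omega> $ i + K / 3 * (\<Sum>j\<in>UNIV. sin (\<theta> t $ j - \<theta> t $ i)))))"

end

theory Submission
  imports Defs
begin

text \<open>After a transient the velocities of the second-order system follow the first-order field up to
  an error of order \<open>m K\<^sup>2\<close>. If then \<open>cos (\<theta> i - \<theta> j) = 1 / 2\<close>, the mutual attraction of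
  \<open>i\<close> and \<open>j\<close> beats the third oscillator, the frequency mismatch and the inertial error together,
  so the two phases approach each other; hence \<open>cos (\<theta> i - \<theta> j) > 1 / 2\<close> persists once it holds.
  So each phase difference either never meets \<open>2 \<pi> \<int>\<close> after the transient, or it meets it and then
  never meets \<open>\<pi> + 2 \<pi> \<int>\<close> again; by the intermediate value theorem it is bounded in both cases.
  Consequently the energy, a tilted cosine potential plus kinetic energy in the rotating frame, is
  bounded below along the trajectory. Its dissipation rate is the sum of the squared deviations of
  the velocities from the mean frequency, and Barbalat's lemma yields convergence.\<close>

section \<open>Globally Lipschitz differential equations\<close>

lemma integral_has_vector_derivative_half_line:
  fixes g :: "real \<Rightarrow> 'a::banach"
  assumes "continuous_on {0..} g" and "t \<ge> 0"
  shows "((\<lambda>s. integral {0..s} g) has_vector_derivative g t) (at t within {0..})"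
proof -
  have "((\<lambda>s. integral {0..s} g) has_vector_derivative g t) (at t within {0..t + 1})"
    using assms by (intro integral_has_vector_derivative continuous_on_subset[OF assms(1)]) auto
  moreover have "at t within {0..t + 1} = at t within {0..}"
    by (rule at_within_nhd[of _ "{..<t + 1}"]) auto
  ultimately show ?thesis
    by simp
qed

text \<open>Integrating the weight \<open>exp (c * s)\<close> gains the factor \<open>1 / c\<close>.
  For the Picard operator this gives boundedness of its values and the contraction constant
  \<open>L / c\<close>.\<close>

lemma norm_integral_exp_bound:
  fixes g :: "real \<Rightarrow> 'a::banach"
  assumes "continuous_on {0..} g" and "c > 0" and "M \<ge> 0" and "t \<ge> 0"
    and bound: "\<And>s. s \<ge> 0 \<Longrightarrow> norm (g s) \<le> M * exp (c * s)"
  shows "norm (integral {0..t} g) \<le> M / c * exp (c * t)"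
proof -
  have int: "((\<lambda>s. M * exp (c * s)) has_integral (M / c * exp (c * t) - M / c * exp (c * 0))) {0..t}"
    using assms(2,4)
    by (intro fundamental_theorem_of_calculus)
      (auto intro!: derivative_eq_intros simp flip: has_real_derivative_iff_has_vector_derivative)
  have "norm (integral {0..t} g) \<le> integral {0..t} (\<lambda>s. M * exp (c * s))"
    using int bound
    by (intro integral_norm_bound_integral integrable_continuous_real
        continuous_on_subset[OF assms(1)]) (auto intro!: continuous_intros)
  also have "\<dots> = M / c * exp (c * t) - M / c"
    using integral_unique[OF int] by simp
  also have "\<dots> \<le> M / c * exp (c * t)"
    using assms(2,3) by simp
  finally show ?thesis .
qed

text \<open>The Picard operator is a contraction for the norm weighted by \<open>exp (- c t)\<close> with \<open>c\<close> twice
  the Lipschitz constant; this gives the solution on the whole half-line at once.\<close>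
lemma global_lipschitz_ode_exists:
  fixes F :: "'a::banach \<Rightarrow> 'a"
  assumes "L > 0" and lip: "\<And>x y. norm (F x - F y) \<le> L * norm (x - y)"
  shows "\<exists>y. y 0 = y0 \<and> (\<forall>t\<ge>0. (y has_vector_derivative F (y t)) (at t within {0..}))"
proof -
  define c where "c = 2 * L"
  have c: "c > 0" "L / c = 1 / 2"
    using \<open>L > 0\<close> by (auto simp: c_def)
  have contF: "continuous_on S F" for S
  proof (rule continuous_on_subset)
    show "continuous_on UNIV F"
      by (rule lipschitz_on_continuous_on[of L])
        (use \<open>L > 0\<close> lip in \<open>auto intro!: lipschitz_onI simp: dist_norm\<close>)
  qed simp
  \<comment> \<open>The unknown \<open>z\<close> is the curve already multiplied by
    \<open>exp (- c * s)\<close>, so the weighted norm becomes the plain supremum norm of bounded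
    continuous functions.\<close>
  define g where "g z s = F (exp (c * s) *\<^sub>R apply_bcontfun z s)" for z s
  have contg: "continuous_on S (g z)" for S z
    unfolding g_def
    by (intro continuous_on_compose2[OF contF[of UNIV]] continuous_intros) auto
  \<comment> \<open>Members of the Banach space live on all of \<real>; \<open>max 0 t\<close>
    extends the values constantly to negative times.\<close>
  define P where "P z t = exp (- c * max 0 t) *\<^sub>R (y0 + integral {0..max 0 t} (g z))" for z t
  have "P z \<in> bcontfun" for z
  proof -
    have "continuous_on {0..} (\<lambda>s. integral {0..s} (g z))"
      by (auto intro!: has_vector_derivative_continuous
          integral_has_vector_derivative_half_line contg simp: continuous_on_eq_continuous_within)
    then have "continuous_on UNIV (\<lambda>t. integral {0..max 0 t} (g z))"
      by (rule continuous_on_compose2) (auto intro!: continuous_intros)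
    then have "continuous_on UNIV (P z)"
      unfolding P_def by (intro continuous_intros) auto
    moreover have "bounded (range (P z))"
    proof -
      obtain B where B: "\<And>s. norm (apply_bcontfun z s) \<le> B"
        using bounded_apply_bcontfun[of z] by (auto simp: bounded_iff)
      then have "B \<ge> 0"
        using norm_ge_zero order_trans by blast
      have gb: "norm (g z s) \<le> (norm (F 0) + L * B) * exp (c * s)" if "s \<ge> 0" for s
      proof -
        have "norm (g z s) \<le> norm (F 0) + L * (exp (c * s) * norm (apply_bcontfun z s))"
          using lip[of "exp (c * s) *\<^sub>R apply_bcontfun z s" 0]
            norm_triangle_sub[of "g z s" "F 0"] by (simp add: g_def)
        also have "\<dots> \<le> norm (F 0) * exp (c * s) + L * (exp (c * s) * B)"
          using that c \<open>L > 0\<close> B[of s]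
          by (intro add_mono mult_left_mono) (auto simp: mult_le_cancel_left1)
        finally show ?thesis
          by (simp add: algebra_simps)
      qed
      have "norm (P z t) \<le> norm y0 + (norm (F 0) + L * B) / c" for t
      proof -
        define \<tau> where "\<tau> = max 0 t"
        have "norm (integral {0..\<tau>} (g z)) \<le> (norm (F 0) + L * B) / c * exp (c * \<tau>)"
          using c \<open>L > 0\<close> \<open>B \<ge> 0\<close> gb
          by (intro norm_integral_exp_bound contg) (auto simp: \<tau>_def)
        then have "norm (P z t) \<le> exp (- c * \<tau>) * (norm y0 + (norm (F 0) + L * B) / c * exp (c * \<tau>))"
          unfolding P_def \<tau>_def[symmetric]
          by (auto intro!: norm_triangle_le)
        also have "\<dots> = exp (- c * \<tau>) * norm y0 + (norm (F 0) + L * B) / c"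
          by (simp add: algebra_simps exp_minus)
        also have "exp (- c * \<tau>) * norm y0 \<le> norm y0"
          using c by (intro mult_left_le_one_le) (auto simp: \<tau>_def)
        finally show ?thesis
          by simp
      qed
      then show ?thesis
        by (auto simp: bounded_iff)
    qed
    ultimately show ?thesis
      by (simp add: bcontfun_def)
  qed
  then have P: "apply_bcontfun (Bcontfun (P z)) = P z" for z
    by (rule Bcontfun_inverse)
  have "dist (Bcontfun (P z)) (Bcontfun (P w)) \<le> 1 / 2 * dist z w" for z w
  proof (rule dist_bound, unfold P)
    fix t :: real
    define \<tau> where "\<tau> = max 0 t"
    have [simp]: "g x integrable_on {0..\<tau>}" for x
      by (intro integrable_continuous_real contg)
    have "norm (g z s - g w s) \<le> L * dist z w * exp (c * s)" for s
    proof -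
      have "norm (g z s - g w s) \<le> L * (exp (c * s) * norm (apply_bcontfun z s - apply_bcontfun w s))"
        using lip[of "exp (c * s) *\<^sub>R apply_bcontfun z s" "exp (c * s) *\<^sub>R apply_bcontfun w s"]
        by (simp add: g_def flip: scaleR_diff_right)
      also have "\<dots> \<le> L * (exp (c * s) * dist z w)"
        using \<open>L > 0\<close> dist_bounded[of z s w] by (simp add: dist_norm)
      finally show ?thesis
        by (simp add: mult_ac)
    qed
    then have "norm (integral {0..\<tau>} (\<lambda>s. g z s - g w s)) \<le> L * dist z w / c * exp (c * \<tau>)"
      using c \<open>L > 0\<close>
      by (intro norm_integral_exp_bound continuous_on_diff contg) (auto simp: \<tau>_def)
    also have "\<dots> = 1 / 2 * dist z w * exp (c * \<tau>)"
      using c by (simp add: field_simps)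
    also have "integral {0..\<tau>} (\<lambda>s. g z s - g w s) = integral {0..\<tau>} (g z) - integral {0..\<tau>} (g w)"
      by (intro integral_diff) auto
    finally have *: "norm (integral {0..\<tau>} (g z) - integral {0..\<tau>} (g w)) / exp (c * \<tau>)
        \<le> 1 / 2 * dist z w"
      by (simp add: pos_divide_le_eq)
    have "dist (P z t) (P w t)
        = norm (integral {0..\<tau>} (g z) - integral {0..\<tau>} (g w)) / exp (c * \<tau>)"
      by (simp add: dist_norm P_def exp_minus divide_inverse mult.commute
          flip: \<tau>_def scaleR_diff_right)
    with * show "dist (P z t) (P w t) \<le> 1 / 2 * dist z w"
      by simp
  qed
  then obtain z where "Bcontfun (P z) = z"
    using banach_fix_type[of "1 / 2" "\<lambda>z. Bcontfun (P z)"] by auto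
  then have z: "apply_bcontfun z t = P z t" for t
    using P by metis
  define y where "y t = y0 + integral {0..t} (g z)" for t
  have F: "g z t = F (y t)" if "t \<ge> 0" for t
    using that by (simp add: g_def z P_def y_def exp_minus)
  have "(y has_vector_derivative F (y t)) (at t within {0..})" if "t \<ge> 0" for t
    using integral_has_vector_derivative_half_line[OF contg[of "{0..}" z] that]
      has_vector_derivative_add[OF has_vector_derivative_const[of y0]]
    by (simp add: y_def[abs_def] F[OF that, unfolded y_def, symmetric])
  moreover have "y 0 = y0"
    by (simp add: y_def)
  ultimately show ?thesis
    by blast
qed

text \<open>Gronwall's argument for the squared distance, which is differentiable even where the
  curves meet: its derivative is at most \<open>2 * L\<close> times itself, so the weight
  \<open>exp (- 2 * L * s)\<close> makes it nonincreasing from the value 0. Continuity at 0 and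
  derivatives at positive times suffice, which matches the notion of classical solution.\<close>

lemma lipschitz_ode_unique:
  fixes F :: "'a::real_inner \<Rightarrow> 'a"
  assumes lip: "\<And>x y. norm (F x - F y) \<le> L * norm (x - y)"
    and cont: "continuous_on {0..} x" "continuous_on {0..} y" and "x 0 = y 0"
    and deriv: "\<And>t. t > 0 \<Longrightarrow> (x has_vector_derivative F (x t)) (at t)"
      "\<And>t. t > 0 \<Longrightarrow> (y has_vector_derivative F (y t)) (at t)"
    and "t \<ge> 0"
  shows "x t = y t"
proof -
  define N where "N s = (x s - y s) \<bullet> (x s - y s)" for s
  define q where "q s = exp (- 2 * L * s) * N s" for s
  have "q t \<le> q 0"
  proof (rule DERIV_nonpos_imp_decreasing_open[OF \<open>t \<ge> 0\<close>])
    show "continuous_on {0..t} q"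
      unfolding q_def N_def
      by (intro continuous_intros continuous_on_subset[OF cont(1)] continuous_on_subset[OF cont(2)]) auto
    fix s assume "0 < s" "s < t"
    let ?d = "x s - y s" and ?D = "F (x s) - F (y s)"
    have "(N has_real_derivative 2 * (?D \<bullet> ?d)) (at s)"
      using has_vector_derivative_diff[OF deriv[OF \<open>0 < s\<close>]]
      unfolding has_vector_derivative_def has_field_derivative_def N_def
      by - (rule has_derivative_eq_rhs, rule has_derivative_inner, assumption, assumption,
          simp add: inner_commute fun_eq_iff)
    then have "(q has_real_derivative
        exp (- 2 * L * s) * (2 * (?D \<bullet> ?d) - 2 * L * N s)) (at s)"
      unfolding q_def by (auto intro!: derivative_eq_intros simp: algebra_simps)
    moreover have "?D \<bullet> ?d \<le> L * N s"
    proof -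
      have "?D \<bullet> ?d \<le> norm ?D * norm ?d"
        by (rule norm_cauchy_schwarz)
      also have "\<dots> \<le> L * norm ?d * norm ?d"
        by (intro mult_right_mono lip) auto
      finally show ?thesis
        by (simp add: N_def dot_square_norm power2_eq_square)
    qed
    ultimately show "\<exists>k. (q has_real_derivative k) (at s) \<and> k \<le> 0"
      by (intro exI conjI) (auto simp: mult_le_0_iff)
  qed
  then have "(x t - y t) \<bullet> (x t - y t) \<le> 0"
    using \<open>x 0 = y 0\<close> by (simp add: q_def N_def mult_le_0_iff)
  then show ?thesis
    by (metis eq_iff_diff_eq_0 inner_eq_zero_iff inner_ge_zero order_antisym)
qed

section \<open>Barriers, relaxation and dissipation\<close>

text \<open>At a first time where the level is no longer exceeded, \<open>x\<close> equals
  \<open>b\<close> by the intermediate value theorem. A positive derivative there puts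
  \<open>x\<close> below \<open>b\<close> slightly earlier, against the choice of that time.\<close>

lemma stays_above_barrier:
  fixes x :: "real \<Rightarrow> real"
  assumes deriv: "\<And>t. t \<ge> T \<Longrightarrow> (x has_real_derivative x' t) (at t)"
    and "x T > b" and barrier: "\<And>t. t \<ge> T \<Longrightarrow> x t = b \<Longrightarrow> x' t > 0" and "t \<ge> T"
  shows "x t > b"
proof (rule ccontr)
  assume "\<not> x t > b"
  have cont: "continuous_on {T..u} x" for u
    by (intro continuous_at_imp_continuous_on ballI DERIV_isCont[OF deriv]) auto
  define A where "A = {s \<in> {T..t}. x s \<le> b}"
  have "closed A"
    unfolding A_def by (intro continuous_on_closed_Collect_le cont continuous_on_const closed_atLeastAtMost)
  moreover have "bounded A"
    by (rule bounded_subset[of "{T..t}"]) (auto simp: A_def)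
  ultimately have "compact A"
    by (simp add: compact_eq_bounded_closed)
  moreover have "A \<noteq> {}"
    using \<open>t \<ge> T\<close> \<open>\<not> x t > b\<close> by (auto simp: A_def)
  ultimately obtain s where s: "s \<in> A" and first: "\<And>u. u \<in> A \<Longrightarrow> s \<le> u"
    using compact_attains_inf by metis
  have "x s = b"
  proof (rule ccontr)
    assume "x s \<noteq> b"
    then obtain u where "T \<le> u" "u \<le> s" "x u = b"
      using IVT2'[of x s b T] s \<open>x T > b\<close> cont[of s] by (auto simp: A_def)
    with s first[of u] \<open>x s \<noteq> b\<close> show False
      by (auto simp: A_def)
  qed
  with s barrier \<open>x T > b\<close> have "x' s > 0" "T < s"
    by (auto simp: A_def order.order_iff_strict)
  then obtain d where d: "d > 0" "\<And>h. 0 < h \<Longrightarrow> h < d \<Longrightarrow> x (s - h) < x s"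
    using DERIV_pos_inc_left[OF deriv[of s]] by auto
  \<comment> \<open>Small enough for the derivative to decide the sign, and for \<open>s - h\<close>
    not to precede \<open>T\<close>.\<close>
  define h where "h = min (d / 2) (s - T)"
  have h: "0 < h" "h < d" "h \<le> s - T"
    using \<open>d > 0\<close> \<open>T < s\<close> by (auto simp: h_def)
  with d(2)[of h] \<open>x s = b\<close> s have "s - h \<in> A"
    by (auto simp: A_def)
  with first[of "s - h"] h show False
    by auto
qed

text \<open>A continuous path that avoids all multiples of 2 \<pi> is trapped between two
  consecutive ones. The lower bound is the upper bound for \<open>- x\<close>, since cosine is
  even.\<close>

lemma cos_ne_1_imp_bounded:
  fixes x :: "real \<Rightarrow> real"
  assumes cont: "continuous_on {T..} x" and ne: "\<And>t. t \<ge> T \<Longrightarrow> cos (x t) \<noteq> 1" and "t \<ge> T"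
  shows "\<bar>x t - x T\<bar> \<le> 2 * pi"
proof -
  have upper: "y t \<le> y T + 2 * pi"
    if cont: "continuous_on {T..} y" and ne: "\<And>t. t \<ge> T \<Longrightarrow> cos (y t) \<noteq> 1"
    for y :: "real \<Rightarrow> real"
  proof (rule ccontr)
    assume *: "\<not> y t \<le> y T + 2 * pi"
    \<comment> \<open>The first multiple of 2 \<pi> above \<open>y T\<close>; a larger increase
      would have to cross it.\<close>
    define p where "p = 2 * pi * of_int (\<lfloor>y T / (2 * pi)\<rfloor> + 1)"
    have "y T / (2 * pi) \<le> of_int (\<lfloor>y T / (2 * pi)\<rfloor> + 1)"
        "of_int (\<lfloor>y T / (2 * pi)\<rfloor> + 1) \<le> y T / (2 * pi) + 1"
      by linarith+
    then have "y T \<le> p" "p \<le> y T + 2 * pi"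
      unfolding p_def by (simp_all add: field_simps)
    with * obtain s where "T \<le> s" "s \<le> t" "y s = p"
      using IVT'[of y T p t] \<open>t \<ge> T\<close> continuous_on_subset[OF cont, of "{T..t}"] by auto
    moreover have "cos p = 1"
      unfolding p_def by (rule cos_int_2pin)
    ultimately show False
      using ne by auto
  qed
  show ?thesis
    using upper[OF cont ne] upper[OF continuous_on_minus[OF cont]] ne
    by (auto simp: abs_le_iff)
qed

text \<open>The equation m r' = g - r forgets its initial value:
  \<open>(r t - B) * exp (t / m)\<close> is nonincreasing once \<open>g\<close> is at most
  \<open>B\<close>, so the excess of \<open>r\<close> over \<open>B\<close> is at most an
  exponentially decaying term and any margin \<open>B' > B\<close> absorbs it. With hypotheses and
  conclusion holding only eventually, such estimates can be chained.\<close>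

lemma relaxation_eventually_le:
  fixes r g :: "real \<Rightarrow> real"
  assumes "m > 0" and "B < B'"
    and deriv: "eventually (\<lambda>t. (r has_real_derivative (g t - r t) / m) (at t)) at_top"
    and bound: "eventually (\<lambda>t. g t \<le> B) at_top"
  shows "eventually (\<lambda>t. r t \<le> B') at_top"
proof -
  obtain T where T: "\<And>t. t \<ge> T \<Longrightarrow> (r has_real_derivative (g t - r t) / m) (at t) \<and> g t \<le> B"
    using eventually_conj[OF deriv bound] by (auto simp: eventually_at_top_linorder)
  define q where "q t = (r t - B) * exp (t / m)" for t
  have q: "q t \<le> q T" if "t \<ge> T" for t
  proof (rule DERIV_nonpos_imp_nonincreasing[OF that])
    fix s assume "T \<le> s"
    then have "(q has_real_derivative (g s - B) * exp (s / m) / m) (at s)"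
      using T[of s] \<open>m > 0\<close> unfolding q_def
      by (auto intro!: derivative_eq_intros simp: field_simps)
    moreover have "(g s - B) * exp (s / m) / m \<le> 0"
      using T[of s] \<open>T \<le> s\<close> \<open>m > 0\<close> by (auto simp: divide_le_0_iff mult_le_0_iff)
    ultimately show "\<exists>y. (q has_real_derivative y) (at s) \<and> y \<le> 0"
      by blast
  qed
  have "filterlim (\<lambda>t. - (t * inverse m)) at_bot at_top"
    using \<open>m > 0\<close>
    by (subst filterlim_uminus_at_top[symmetric])
      (auto intro!: filterlim_at_top_mult_tendsto_pos filterlim_ident)
  then have "((\<lambda>t. \<bar>q T\<bar> * exp (- t / m)) \<longlongrightarrow> \<bar>q T\<bar> * 0) at_top"
    by (intro tendsto_intros filterlim_compose[OF exp_at_bot]) (simp add: divide_inverse)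
  then have "eventually (\<lambda>t. \<bar>q T\<bar> * exp (- t / m) < B' - B) at_top"
    using \<open>B < B'\<close> by (auto intro: order_tendstoD)
  then show ?thesis
    using eventually_ge_at_top[of T]
  proof eventually_elim
    case (elim t)
    have "r t - B = q t * exp (- t / m)"
      by (simp add: q_def flip: exp_add)
    also have "\<dots> \<le> \<bar>q T\<bar> * exp (- t / m)"
      using q[OF elim(2)] by (intro mult_right_mono) auto
    finally show ?case
      using elim(1) by linarith
  qed
qed

lemma relaxation_eventually_abs_le:
  fixes r g :: "real \<Rightarrow> real"
  assumes "m > 0" and "B < B'"
    and deriv: "eventually (\<lambda>t. (r has_real_derivative (g t - r t) / m) (at t)) at_top"
    and bound: "eventually (\<lambda>t. \<bar>g t\<bar> \<le> B) at_top"
  shows "eventually (\<lambda>t. \<bar>r t\<bar> \<le> B') at_top"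
proof -
  have "eventually (\<lambda>t. r t \<le> B') at_top"
    by (rule relaxation_eventually_le[OF assms(1,2) deriv])
      (use bound in eventually_elim, simp)
  moreover have "eventually (\<lambda>t. - r t \<le> B') at_top"
  proof (rule relaxation_eventually_le[OF assms(1,2)])
    show "eventually (\<lambda>t. ((\<lambda>t. - r t) has_real_derivative (- g t - (- r t)) / m) (at t)) at_top"
      using deriv
    proof eventually_elim
      case (elim t)
      show ?case
        using DERIV_minus[OF elim] by (simp add: minus_divide_left)
    qed
    show "eventually (\<lambda>t. - g t \<le> B) at_top"
      using bound by eventually_elim simp
  qed
  ultimately show ?thesis
    by eventually_elim simp
qed

text \<open>Beyond a time where \<open>E\<close> is close to its infimum, a large value of
  \<open>w\<close> is impossible: the bound on \<open>w'\<close> would keep \<open>w\<close> large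
  for a fixed time \<open>h\<close>, and the dissipation would push \<open>E\<close> below the
  infimum.\<close>

lemma barbalat_dissipation:
  fixes E w :: "real \<Rightarrow> real"
  assumes deriv_E: "\<And>t. t \<ge> T \<Longrightarrow> \<exists>D. (E has_real_derivative D) (at t) \<and> D \<le> - (w t)\<^sup>2"
    and lower: "\<And>t. t \<ge> T \<Longrightarrow> E t \<ge> b"
    and deriv_w: "\<And>t. t \<ge> T \<Longrightarrow> (w has_real_derivative w' t) (at t)"
    and bound_w': "\<And>t. t \<ge> T \<Longrightarrow> \<bar>w' t\<bar> \<le> B"
  shows "(w \<longlongrightarrow> 0) at_top"
proof (rule tendstoI)
  fix e :: real assume "e > 0"
  define I where "I = Inf (E ` {T..})"
  \<comment> \<open>Within time \<open>h\<close> the function \<open>w\<close> changes by at most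
    \<open>e / 2\<close>; the summand 1 keeps the denominator positive.\<close>
  define h where "h = e / (2 * (\<bar>B\<bar> + 1))"
  have "h > 0"
    using \<open>e > 0\<close> by (auto simp: h_def intro!: divide_pos_pos)
  have bdd: "bdd_below (E ` {T..})"
    using lower by (intro bdd_belowI2) auto
  have I: "I \<le> E t" if "t \<ge> T" for t
    unfolding I_def using that bdd by (intro cInf_lower) auto
  have "I < I + (e / 2)\<^sup>2 * h"
    using \<open>e > 0\<close> \<open>h > 0\<close> by simp
  then have "\<exists>a\<in>E ` {T..}. a < I + (e / 2)\<^sup>2 * h"
    unfolding I_def by (intro cInf_lessD) simp_all
  then obtain t0 where t0: "t0 \<ge> T" "E t0 < I + (e / 2)\<^sup>2 * h"
    by blast
  have "\<bar>w t\<bar> < e" if "t \<ge> t0" for t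
  proof (rule ccontr)
    assume "\<not> \<bar>w t\<bar> < e"
    have "E t \<le> E t0"
    proof (rule DERIV_nonpos_imp_nonincreasing[OF that])
      fix s assume "t0 \<le> s"
      then obtain D where "(E has_real_derivative D) (at s)" "D \<le> - (w s)\<^sup>2"
        using deriv_E[of s] t0(1) by auto
      moreover have "- (w s)\<^sup>2 \<le> 0"
        by simp
      ultimately show "\<exists>y. (E has_real_derivative y) (at s) \<and> y \<le> 0"
        using order_trans by blast
    qed
    have w: "\<bar>w s\<bar> \<ge> e / 2" if "t \<le> s" "s \<le> t + h" for s
    proof -
      have "norm (w s - w t) \<le> (\<bar>B\<bar> + 1) * norm (s - t)"
      proof (rule field_differentiable_bound[of "{t..s}"])
        fix u assume "u \<in> {t..s}"
        with \<open>t \<ge> t0\<close> t0(1) show "(w has_field_derivative w' u) (at u within {t..s})"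
          by (intro DERIV_subset[OF deriv_w]) auto
        show "norm (w' u) \<le> \<bar>B\<bar> + 1"
          using \<open>u \<in> {t..s}\<close> \<open>t \<ge> t0\<close> t0(1) bound_w'[of u] by auto
      qed (use that in auto)
      also have "\<dots> \<le> (\<bar>B\<bar> + 1) * h"
        using that by (intro mult_left_mono) auto
      also have "\<dots> = e / 2"
        by (simp add: h_def field_simps)
      finally show ?thesis
        using \<open>\<not> \<bar>w t\<bar> < e\<close> by (simp add: abs_if split: if_splits)
    qed
    have "E (t + h) + (e / 2)\<^sup>2 * (t + h) \<le> E t + (e / 2)\<^sup>2 * t"
    proof (rule DERIV_nonpos_imp_nonincreasing[of t "t + h" "\<lambda>s. E s + (e / 2)\<^sup>2 * s"])
      fix s assume s: "t \<le> s" "s \<le> t + h"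
      then obtain D where D: "(E has_real_derivative D) (at s)" "D \<le> - (w s)\<^sup>2"
        using deriv_E[of s] \<open>t \<ge> t0\<close> t0(1) by auto
      moreover have "(e / 2)\<^sup>2 \<le> (w s)\<^sup>2"
        using w[OF s] \<open>e > 0\<close> by (metis abs_le_square_iff abs_of_pos half_gt_zero)
      ultimately show "\<exists>y. ((\<lambda>s. E s + (e / 2)\<^sup>2 * s) has_real_derivative y) (at s) \<and> y \<le> 0"
        by (intro exI[of _ "D + (e / 2)\<^sup>2"]) (auto intro!: derivative_eq_intros)
    qed (use \<open>h > 0\<close> in auto)
    with \<open>E t \<le> E t0\<close> t0 I[of "t + h"] \<open>t \<ge> t0\<close> \<open>h > 0\<close> show False
      by (simp add: algebra_simps)
  qed
  then show "eventually (\<lambda>t. dist (w t) 0 < e) at_top"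
    by (auto simp: eventually_at_top_linorder)
qed

section \<open>Kuramoto trajectories\<close>

definition coupling :: "real \<Rightarrow> real ^ 3 \<Rightarrow> 3 \<Rightarrow> real" where
  "coupling K x i = K / 3 * (\<Sum>j\<in>UNIV. sin (x $ j - x $ i))"

text \<open>The summand \<open>j = i\<close> vanishes, hence two thirds of \<open>K\<close> instead
  of all of it.\<close>

lemma abs_coupling_le:
  assumes "K \<ge> 0"
  shows "\<bar>coupling K x i\<bar> \<le> 2 / 3 * K"
proof -
  have "\<bar>\<Sum>j\<in>UNIV. sin (x $ j - x $ i)\<bar> \<le> (\<Sum>j\<in>UNIV - {i}. \<bar>sin (x $ j - x $ i)\<bar>)"
    by (simp add: sum.remove[of UNIV i] sum_abs)
  also have "\<dots> \<le> (\<Sum>j\<in>UNIV - {i}. 1)"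
    by (intro sum_mono abs_sin_le_one)
  finally have "K / 3 * \<bar>\<Sum>j\<in>UNIV. sin (x $ j - x $ i)\<bar> \<le> K / 3 * 2"
    using assms by (intro mult_left_mono) auto
  then show ?thesis
    using assms by (simp add: coupling_def abs_mult)
qed

text \<open>By the addition theorem the difference is itself a single sine, that of
  \<open>2 * a - b\<close>.\<close>

lemma abs_sin_diff_le_1:
  fixes a b :: real
  assumes "cos (a - b) = 1 / 2"
  shows "\<bar>sin a - sin b\<bar> \<le> 1"
proof -
  have "sin (a + (a - b)) + sin (a - (a - b)) = 2 * sin a * cos (a - b)"
    unfolding sin_add sin_diff[of a "a - b"] by simp
  then have "sin a - sin b = sin (a + (a - b))"
    using assms by simp
  then show ?thesis
    by simp
qed

text \<open>Only \<open>cos (x i - x j) = 1 / 2\<close> is used about the pair: the third phase then contributes at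
  most \<open>K / 3\<close>, wherever it is.\<close>
lemma coupling_diff_at_barrier:
  assumes "i \<noteq> j" and "cos (x $ i - x $ j) = 1 / 2"
  obtains s where "\<bar>s\<bar> \<le> 1"
    and "coupling K x i - coupling K x j = - K / 3 * (2 * sin (x $ i - x $ j) + s)"
proof -
  have "card (UNIV - {i, j}) = 1"
    using assms(1) by (simp add: card_Diff_subset)
  then obtain k where "UNIV - {i, j} = {k}"
    by (rule card_1_singletonE)
  then have k: "UNIV = {i, j, k}" "k \<noteq> i" "k \<noteq> j"
    by blast+
  \<comment> \<open>The two arguments through which the third phase enters differ by exactly
    \<open>x $ i - x $ j\<close>.\<close>
  have "cos ((x $ k - x $ j) - (x $ k - x $ i)) = 1 / 2"
    using assms(2) by simp
  then have *: "\<bar>sin (x $ k - x $ j) - sin (x $ k - x $ i)\<bar> \<le> 1"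
    by (rule abs_sin_diff_le_1)
  have "sin (x $ j - x $ i) = - sin (x $ i - x $ j)"
    by (metis minus_diff_eq sin_minus)
  moreover have "(\<Sum>l\<in>UNIV. f l) = f i + f j + f k" for f :: "3 \<Rightarrow> real"
    unfolding k(1) using k(2,3) assms(1) by simp
  ultimately have "coupling K x i - coupling K x j
      = - K / 3 * (2 * sin (x $ i - x $ j) + (sin (x $ k - x $ j) - sin (x $ k - x $ i)))"
    unfolding coupling_def by (simp add: algebra_simps)
  with * show ?thesis
    by (rule that)
qed

text \<open>The componentwise system at positive times, where derivatives are two-sided; the
  asymptotics do not refer to the initial data.\<close>

locale kuramoto_trajectory =
  fixes m K :: real and \<Omega> :: "real ^ 3" and \<theta> v :: "real \<Rightarrow> real ^ 3"
  assumes m_pos: "m > 0" and K_pos: "K > 0"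
    and deriv_phase: "t > 0 \<Longrightarrow> ((\<lambda>t. \<theta> t $ i) has_real_derivative v t $ i) (at t)"
    and deriv_velocity: "t > 0 \<Longrightarrow>
      ((\<lambda>t. v t $ i) has_real_derivative (\<Omega> $ i + coupling K (\<theta> t) i - v t $ i) / m) (at t)"
begin

lemma deriv_coupling:
  assumes "t > 0"
  shows "((\<lambda>t. coupling K (\<theta> t) i) has_real_derivative
    K / 3 * (\<Sum>j\<in>UNIV. cos (\<theta> t $ j - \<theta> t $ i) * (v t $ j - v t $ i))) (at t)"
  unfolding coupling_def
  by (auto intro!: derivative_eq_intros deriv_phase assms simp: algebra_simps)

text \<open>Relaxation towards a forcing of size at most
  \<open>\<bar>\<Omega> $ i\<bar> + 2 / 3 * K\<close>. It later bounds the accelerations, as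
  Barbalat's lemma requires.\<close>

lemma velocity_eventually_bounded:
  "eventually (\<lambda>t. \<bar>v t $ i\<bar> \<le> \<bar>\<Omega> $ i\<bar> + K) at_top"
proof (rule relaxation_eventually_abs_le[OF m_pos, of "\<bar>\<Omega> $ i\<bar> + 2 / 3 * K"])
  show "eventually (\<lambda>t. ((\<lambda>t. v t $ i) has_real_derivative
      (\<Omega> $ i + coupling K (\<theta> t) i - v t $ i) / m) (at t)) at_top"
    using eventually_gt_at_top[of 0] by eventually_elim (rule deriv_velocity)
  show "eventually (\<lambda>t. \<bar>\<Omega> $ i + coupling K (\<theta> t) i\<bar> \<le> \<bar>\<Omega> $ i\<bar> + 2 / 3 * K) at_top"
    using abs_coupling_le[of K] K_pos
    by (auto intro!: always_eventually order_trans[OF abs_triangle_ineq] add_left_mono)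
qed (use K_pos in auto)

text \<open>The quantity estimated here vanishes for \<open>m = 0\<close>: it measures the deviation from the
  first-order model. The numbers \<open>8 / 100\<close> and \<open>525 / 10000\<close> are crude upper bounds for
  \<open>lambda3\<close> (about 0.046) and for the admissible \<open>m * K\<close> (about 0.032).\<close>
lemma first_order_defect_eventually_le:
  assumes small_freq: "\<And>i j. \<bar>\<Omega> $ i - \<Omega> $ j\<bar> \<le> 8 / 100 * K" and small_inertia: "m * K \<le> 525 / 10000"
  shows "eventually (\<lambda>t. \<bar>(v t $ i - v t $ j) -
    ((\<Omega> $ i - \<Omega> $ j) + (coupling K (\<theta> t) i - coupling K (\<theta> t) j))\<bar> \<le> 1 / 10 * K) at_top"
proof -
  let ?c = "\<lambda>i t. coupling K (\<theta> t) i"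
  let ?c' = "\<lambda>i t. K / 3 * (\<Sum>j\<in>UNIV. cos (\<theta> t $ j - \<theta> t $ i) * (v t $ j - v t $ i))"
  \<comment> \<open>The forcing of the velocity difference is at most (0.08 + 4/3) K, just below
    1.42 K.\<close>
  have speed: "eventually (\<lambda>t. \<bar>v t $ i - v t $ j\<bar> \<le> 142 / 100 * K) at_top" for i j
  proof (rule relaxation_eventually_abs_le[OF m_pos, of "8 / 100 * K + 4 / 3 * K"])
    show "eventually (\<lambda>t. ((\<lambda>t. v t $ i - v t $ j) has_real_derivative
        (((\<Omega> $ i - \<Omega> $ j) + (?c i t - ?c j t)) - (v t $ i - v t $ j)) / m) (at t)) at_top"
      using eventually_gt_at_top[of 0]
    proof eventually_elim
      case (elim t)
      show ?case
        using DERIV_diff[OF deriv_velocity[OF elim, of i] deriv_velocity[OF elim, of j]]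
        by (simp add: algebra_simps flip: diff_divide_distrib)
    qed
    have "\<bar>(\<Omega> $ i - \<Omega> $ j) + (?c i t - ?c j t)\<bar> \<le> 8 / 100 * K + 4 / 3 * K" for t
      using small_freq[of i j] abs_coupling_le[of K "\<theta> t" i] abs_coupling_le[of K "\<theta> t" j] K_pos
      by linarith
    then show "eventually (\<lambda>t. \<bar>(\<Omega> $ i - \<Omega> $ j) + (?c i t - ?c j t)\<bar> \<le> 8 / 100 * K + 4 / 3 * K) at_top"
      by simp
  qed (use K_pos in simp)
  have c': "eventually (\<lambda>t. \<bar>?c' i t\<bar> \<le> 2 / 3 * K * (142 / 100 * K)) at_top" for i
  proof -
    have "eventually (\<lambda>t. \<forall>j. \<bar>v t $ j - v t $ i\<bar> \<le> 142 / 100 * K) at_top"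
      by (intro eventually_all_finite speed)
    then show ?thesis
    proof eventually_elim
      case (elim t)
      have "\<bar>\<Sum>j\<in>UNIV. cos (\<theta> t $ j - \<theta> t $ i) * (v t $ j - v t $ i)\<bar>
          \<le> (\<Sum>j\<in>UNIV - {i}. \<bar>cos (\<theta> t $ j - \<theta> t $ i) * (v t $ j - v t $ i)\<bar>)"
        by (simp add: sum.remove[of UNIV i] sum_abs)
      also have "\<dots> \<le> (\<Sum>j\<in>UNIV - {i}. 1 * (142 / 100 * K))"
        unfolding abs_mult using elim by (intro sum_mono mult_mono) auto
      finally have "K / 3 * \<bar>\<Sum>j\<in>UNIV. cos (\<theta> t $ j - \<theta> t $ i) * (v t $ j - v t $ i)\<bar>
          \<le> K / 3 * (2 * (142 / 100 * K))"
        using K_pos by (intro mult_left_mono) auto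
      then show ?case
        using K_pos by (simp add: abs_mult)
    qed
  qed
  show ?thesis
  \<comment> \<open>The defect obeys a relaxation equation too, forced by \<open>- m\<close> times
    the derivative of the coupling difference. This forcing has order m K^2, and the product of the
    constants is about 0.0994, leaving a margin below 1/10.\<close>
  proof (rule relaxation_eventually_abs_le[OF m_pos, of "525 / 10000 * (4 / 3 * (142 / 100 * K))"])
    show "eventually (\<lambda>t. ((\<lambda>t. (v t $ i - v t $ j) - ((\<Omega> $ i - \<Omega> $ j) + (?c i t - ?c j t)))
        has_real_derivative (- m * (?c' i t - ?c' j t) -
          ((v t $ i - v t $ j) - ((\<Omega> $ i - \<Omega> $ j) + (?c i t - ?c j t)))) / m) (at t)) at_top"
      using eventually_gt_at_top[of 0]
    proof eventually_elim
      case (elim t)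
      show ?case
        by (rule derivative_eq_intros deriv_velocity[OF elim] deriv_coupling[OF elim] refl)+
          (use m_pos in \<open>simp add: field_simps\<close>)
    qed
    show "eventually (\<lambda>t. \<bar>- m * (?c' i t - ?c' j t)\<bar> \<le> 525 / 10000 * (4 / 3 * (142 / 100 * K))) at_top"
      using c'[of i] c'[of j]
    proof eventually_elim
      case (elim t)
      have "\<bar>- m * (?c' i t - ?c' j t)\<bar> = m * \<bar>?c' i t - ?c' j t\<bar>"
        using m_pos by (simp add: abs_mult)
      also have "\<dots> \<le> m * (4 / 3 * K * (142 / 100 * K))"
        using elim m_pos by (intro mult_left_mono) linarith+
      also have "\<dots> = (m * K) * (4 / 3 * (142 / 100 * K))"
        by simp
      also have "\<dots> \<le> 525 / 10000 * (4 / 3 * (142 / 100 * K))"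
        using small_inertia K_pos by (intro mult_right_mono) auto
      finally show ?case .
    qed
  qed (use K_pos in simp)
qed

text \<open>Either the difference avoids all multiples of 2 \<pi> after the transient, or from such
  a meeting on the barrier at cosine 1/2 keeps it away from the odd multiples of \<pi>. Both cases
  reduce to \<open>cos_ne_1_imp_bounded\<close>.\<close>

lemma phase_difference_eventually_bounded:
  assumes small_freq: "\<And>i j. \<bar>\<Omega> $ i - \<Omega> $ j\<bar> \<le> 8 / 100 * K" and small_inertia: "m * K \<le> 525 / 10000"
  shows "\<exists>M. eventually (\<lambda>t. \<bar>\<theta> t $ i - \<theta> t $ j\<bar> \<le> M) at_top"
proof (cases "i = j")
  case True
  then show ?thesis
    by (auto intro!: exI[of _ 0])
next
  case False
  let ?x = "\<lambda>t. \<theta> t $ i - \<theta> t $ j"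
  let ?F = "\<lambda>t. (\<Omega> $ i - \<Omega> $ j) + (coupling K (\<theta> t) i - coupling K (\<theta> t) j)"
  obtain T where "T > 0" and defect: "\<And>t. t \<ge> T \<Longrightarrow> \<bar>(v t $ i - v t $ j) - ?F t\<bar> \<le> 1 / 10 * K"
    using eventually_conj[OF first_order_defect_eventually_le[OF assms, of i j] eventually_gt_at_top[of 0]]
    by (auto simp: eventually_at_top_linorder)
  have cont: "continuous_on {s..} ?x" if "s \<ge> T" for s
    using that \<open>T > 0\<close>
    by (intro continuous_at_imp_continuous_on ballI continuous_intros DERIV_isCont[OF deriv_phase]) auto
  have barrier: "- sin (?x t) * (v t $ i - v t $ j) > 0" if "t \<ge> T" and half: "cos (?x t) = 1 / 2" for t
  proof -
    obtain s where s: "\<bar>s\<bar> \<le> 1"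
      "coupling K (\<theta> t) i - coupling K (\<theta> t) j = - K / 3 * (2 * sin (?x t) + s)"
      using coupling_diff_at_barrier[OF False half] .
    \<comment> \<open>Everything except the mutual attraction: 0.1 K from inertia, 0.08 K from the
      frequencies and K/3 from the third oscillator, together below 0.52 K. With the sine at most
      0.9 in absolute value this costs at most 0.468 K, against the gain (2 K / 3) (3/4) =
      K/2.\<close>
    define p where "p = (v t $ i - v t $ j) - ?F t + (\<Omega> $ i - \<Omega> $ j) - K / 3 * s"
    have "\<bar>K / 3 * s\<bar> \<le> K / 3"
      using s(1) K_pos by (simp add: abs_mult)
    with defect[OF \<open>t \<ge> T\<close>] small_freq[of i j] have p: "\<bar>p\<bar> \<le> 52 / 100 * K"
      unfolding p_def by linarith
    have sin2: "(sin (?x t))\<^sup>2 = 3 / 4"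
      using sin_cos_squared_add[of "?x t"] by (simp only: half) (simp add: power2_eq_square)
    have "\<bar>sin (?x t)\<bar> \<le> 9 / 10"
      by (rule power2_le_imp_le) (simp_all add: sin2 power_divide)
    then have "\<bar>sin (?x t) * p\<bar> \<le> 9 / 10 * (52 / 100 * K)"
      unfolding abs_mult using p by (intro mult_mono) auto
    moreover have "v t $ i - v t $ j = p - 2 * K / 3 * sin (?x t)"
      unfolding p_def s(2) by (simp add: algebra_simps)
    then have "- sin (?x t) * (v t $ i - v t $ j) = 2 * K / 3 * (sin (?x t))\<^sup>2 - sin (?x t) * p"
      by (simp only:) (simp add: algebra_simps power2_eq_square)
    ultimately show ?thesis
      using K_pos unfolding sin2 by linarith
  qed
  \<comment> \<open>The shift \<open>c\<close> serves both cases: 0 for avoiding 2 \<pi> \<int>, and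
    \<open>pi\<close> for avoiding \<pi> + 2 \<pi> \<int>.\<close>
  have bounded: "\<exists>M. eventually (\<lambda>t. \<bar>?x t\<bar> \<le> M) at_top"
    if "s \<ge> T" and "\<And>t. t \<ge> s \<Longrightarrow> cos (?x t + c) \<noteq> 1" for s c
  proof -
    have "\<bar>(?x t + c) - (?x s + c)\<bar> \<le> 2 * pi" if "t \<ge> s" for t
      using \<open>\<And>t. t \<ge> s \<Longrightarrow> cos (?x t + c) \<noteq> 1\<close> that
      by (intro cos_ne_1_imp_bounded continuous_on_add cont[OF \<open>s \<ge> T\<close>] continuous_on_const) auto
    then have "\<bar>?x t\<bar> \<le> \<bar>?x s\<bar> + 2 * pi" if "t \<ge> s" for t
      using that by fastforce
    then show ?thesis
      by (auto simp: eventually_at_top_linorder)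
  qed
  show ?thesis
  proof (cases "\<exists>s\<ge>T. cos (?x s) = 1")
    case False
    then show ?thesis
      using bounded[of T 0] by auto
  next
    case True
    then obtain s where "s \<ge> T" "cos (?x s) = 1"
      by blast
    have "cos (?x t) > 1 / 2" if "t \<ge> s" for t
    proof (rule stays_above_barrier[of s "\<lambda>t. cos (?x t)" "\<lambda>t. - sin (?x t) * (v t $ i - v t $ j)"])
      fix t assume "t \<ge> s"
      with \<open>s \<ge> T\<close> \<open>T > 0\<close> have "t > 0"
        by simp
      show "((\<lambda>t. cos (?x t)) has_real_derivative - sin (?x t) * (v t $ i - v t $ j)) (at t)"
        by (rule derivative_eq_intros deriv_phase[OF \<open>t > 0\<close>] refl)+
    qed (use \<open>s \<ge> T\<close> \<open>cos (?x s) = 1\<close> barrier that in auto)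
    then show ?thesis
      using bounded[OF \<open>s \<ge> T\<close>, of pi] by fastforce
  qed
qed

text \<open>The energy dissipates at the rate \<open>\<Sum> (v i - mean)\<^sup>2\<close>. Its potential part is a tilted cosine
  potential, bounded below along the trajectory because the tilt only involves phase differences.\<close>
lemma velocity_tendsto_mean_freq:
  assumes small_freq: "\<And>i j. \<bar>\<Omega> $ i - \<Omega> $ j\<bar> \<le> 8 / 100 * K" and small_inertia: "m * K \<le> 525 / 10000"
  shows "((\<lambda>t. v t $ i) \<longlongrightarrow> mean_freq \<Omega>) at_top"
proof -
  define \<omega> where "\<omega> = mean_freq \<Omega>"
  \<comment> \<open>This makes the tilt invariant under a common shift of all phases, and removes
    the term linear in \<omega> from the derivative of \<open>E\<close>.\<close>
  have sum0: "(\<Omega> $ 1 - \<omega>) + (\<Omega> $ 2 - \<omega>) + (\<Omega> $ 3 - \<omega>) = 0"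
    by (simp add: \<omega>_def mean_freq_def field_simps)
  define E where "E t = m / 2 * (\<Sum>i\<in>UNIV. (v t $ i - \<omega>)\<^sup>2) - (\<Sum>i\<in>UNIV. (\<Omega> $ i - \<omega>) * \<theta> t $ i)
    - K / 3 * (cos (\<theta> t $ 1 - \<theta> t $ 2) + cos (\<theta> t $ 2 - \<theta> t $ 3) + cos (\<theta> t $ 3 - \<theta> t $ 1))" for t
  obtain M where M: "\<And>i. eventually (\<lambda>t. \<bar>\<theta> t $ i - \<theta> t $ 1\<bar> \<le> M i) at_top"
    using phase_difference_eventually_bounded[OF assms, of _ 1] by metis
  have "eventually (\<lambda>t. \<forall>i. \<bar>\<theta> t $ i - \<theta> t $ 1\<bar> \<le> M i \<and> \<bar>v t $ i\<bar> \<le> \<bar>\<Omega> $ i\<bar> + K) at_top"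
    by (intro eventually_all_finite eventually_conj M velocity_eventually_bounded)
  from eventually_conj[OF this eventually_gt_at_top[of 0]]
  obtain T where T': "\<And>t. t \<ge> T \<Longrightarrow>
      (\<forall>i. \<bar>\<theta> t $ i - \<theta> t $ 1\<bar> \<le> M i \<and> \<bar>v t $ i\<bar> \<le> \<bar>\<Omega> $ i\<bar> + K) \<and> 0 < t"
    unfolding eventually_at_top_linorder by blast
  then have "T > 0"
    by blast
  have T: "\<bar>\<theta> t $ i - \<theta> t $ 1\<bar> \<le> M i" "\<bar>v t $ i\<bar> \<le> \<bar>\<Omega> $ i\<bar> + K" if "t \<ge> T" for t i
    using T'[OF that] by blast+
  have deriv_E: "(E has_real_derivative - (\<Sum>i\<in>UNIV. (v t $ i - \<omega>)\<^sup>2)) (at t)" if "t > 0" for t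
  proof -
    let ?w = "\<lambda>i. v t $ i - \<omega>" and ?s = "\<lambda>i j. sin (\<theta> t $ i - \<theta> t $ j)"
    have anti: "?s 2 1 = - ?s 1 2" "?s 3 2 = - ?s 2 3" "?s 1 3 = - ?s 3 1"
      by (metis minus_diff_eq sin_minus)+
    have "(E has_real_derivative
        (\<Sum>i\<in>UNIV. ?w i * (\<Omega> $ i + coupling K (\<theta> t) i - v t $ i)) - (\<Sum>i\<in>UNIV. (\<Omega> $ i - \<omega>) * v t $ i)
        + K / 3 * (?s 1 2 * (v t $ 1 - v t $ 2) + ?s 2 3 * (v t $ 2 - v t $ 3) + ?s 3 1 * (v t $ 3 - v t $ 1)))
        (at t)"
      unfolding E_def
      by (rule derivative_eq_intros deriv_phase[OF that] deriv_velocity[OF that] refl)+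
        (use m_pos in \<open>simp add: field_simps sum_3\<close>)
    \<comment> \<open>Since sine is odd, the couplings sum to zero and their power cancels the
      derivative of the cosine potential.\<close>
    also have "(\<Sum>i\<in>UNIV. ?w i * (\<Omega> $ i + coupling K (\<theta> t) i - v t $ i)) - (\<Sum>i\<in>UNIV. (\<Omega> $ i - \<omega>) * v t $ i)
        + K / 3 * (?s 1 2 * (v t $ 1 - v t $ 2) + ?s 2 3 * (v t $ 2 - v t $ 3) + ?s 3 1 * (v t $ 3 - v t $ 1))
      = - (\<Sum>i\<in>UNIV. (?w i)\<^sup>2) - \<omega> * ((\<Omega> $ 1 - \<omega>) + (\<Omega> $ 2 - \<omega>) + (\<Omega> $ 3 - \<omega>))"
      by (simp add: coupling_def sum_3 anti power2_eq_square field_simps)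
    finally show ?thesis
      by (simp only: sum0) simp
  qed
  show ?thesis
  proof (rule LIM_zero_cancel, fold \<omega>_def, rule barbalat_dissipation[of T E])
    fix t assume "t \<ge> T"
    then have "t > 0"
      using \<open>T > 0\<close> by simp
    have "(v t $ i - \<omega>)\<^sup>2 \<le> (\<Sum>i\<in>UNIV. (v t $ i - \<omega>)\<^sup>2)"
      by (rule member_le_sum) auto
    with deriv_E[OF \<open>t > 0\<close>]
    show "\<exists>D. (E has_real_derivative D) (at t) \<and> D \<le> - (v t $ i - \<omega>)\<^sup>2"
      by (intro exI conjI) auto
    show "((\<lambda>t. v t $ i - \<omega>) has_real_derivative (\<Omega> $ i + coupling K (\<theta> t) i - v t $ i) / m) (at t)"
      using DERIV_diff[OF deriv_velocity[OF \<open>t > 0\<close>] DERIV_const] by simp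
    show "\<bar>(\<Omega> $ i + coupling K (\<theta> t) i - v t $ i) / m\<bar> \<le> (2 * \<bar>\<Omega> $ i\<bar> + 2 * K) / m"
      using T(2)[OF \<open>t \<ge> T\<close>, of i] abs_coupling_le[of K "\<theta> t" i] K_pos m_pos
      by (simp add: divide_right_mono)
    have tilt: "(\<Sum>i\<in>UNIV. (\<Omega> $ i - \<omega>) * \<theta> t $ i) \<le> (\<Sum>i\<in>UNIV. \<bar>\<Omega> $ i - \<omega>\<bar> * M i)"
    proof -
      \<comment> \<open>Phases are measured relative to the first one, whose coefficient is the
        vanishing sum \<open>sum0\<close>.\<close>
      have "(\<Sum>i\<in>UNIV. (\<Omega> $ i - \<omega>) * \<theta> t $ i)
          = (\<Sum>i\<in>UNIV. (\<Omega> $ i - \<omega>) * (\<theta> t $ i - \<theta> t $ 1))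
            + \<theta> t $ 1 * ((\<Omega> $ 1 - \<omega>) + (\<Omega> $ 2 - \<omega>) + (\<Omega> $ 3 - \<omega>))"
        by (simp add: sum_3 algebra_simps)
      also have "\<dots> = (\<Sum>i\<in>UNIV. (\<Omega> $ i - \<omega>) * (\<theta> t $ i - \<theta> t $ 1))"
        by (simp only: sum0 mult_zero_right add_0_right)
      also have "\<dots> \<le> (\<Sum>i\<in>UNIV. \<bar>\<Omega> $ i - \<omega>\<bar> * \<bar>\<theta> t $ i - \<theta> t $ 1\<bar>)"
        by (intro sum_mono) (simp flip: abs_mult)
      also have "\<dots> \<le> (\<Sum>i\<in>UNIV. \<bar>\<Omega> $ i - \<omega>\<bar> * M i)"
        using T(1)[OF \<open>t \<ge> T\<close>] by (intro sum_mono mult_left_mono) auto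
      finally show ?thesis .
    qed
    have "K / 3 * (cos (\<theta> t $ 1 - \<theta> t $ 2) + cos (\<theta> t $ 2 - \<theta> t $ 3) + cos (\<theta> t $ 3 - \<theta> t $ 1)) \<le> K / 3 * 3"
      using cos_le_one[of "\<theta> t $ 1 - \<theta> t $ 2"] cos_le_one[of "\<theta> t $ 2 - \<theta> t $ 3"]
        cos_le_one[of "\<theta> t $ 3 - \<theta> t $ 1"] K_pos
      by (intro mult_left_mono) linarith+
    moreover have "m / 2 * (\<Sum>i\<in>UNIV. (v t $ i - \<omega>)\<^sup>2) \<ge> 0"
      using m_pos by (intro mult_nonneg_nonneg sum_nonneg) auto
    ultimately show "- (\<Sum>i\<in>UNIV. \<bar>\<Omega> $ i - \<omega>\<bar> * M i) - K \<le> E t"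
      unfolding E_def using tilt by linarith
  qed
qed

end

section \<open>The phase space field and smoothness\<close>

definition second_order_field :: "real \<Rightarrow> real \<Rightarrow> real ^ 3 \<Rightarrow> (real ^ 3) \<times> (real ^ 3) \<Rightarrow> (real ^ 3) \<times> (real ^ 3)" where
  "second_order_field m K \<Omega> p = (snd p, \<chi> i. (\<Omega> $ i + coupling K (fst p) i - snd p $ i) / m)"

lemma abs_coupling_diff_le:
  assumes "K \<ge> 0"
  shows "\<bar>coupling K x i - coupling K y i\<bar> \<le> 2 * K * norm (x - y)"
proof -
  have sin_lip: "\<bar>sin a - sin b\<bar> \<le> \<bar>a - b\<bar>" for a b :: real
  proof -
    have "\<bar>sin a - sin b\<bar> = 2 * \<bar>sin ((a - b) / 2)\<bar> * \<bar>cos ((a + b) / 2)\<bar>"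
      by (simp add: sin_diff_sin abs_mult)
    also have "\<dots> \<le> 2 * \<bar>(a - b) / 2\<bar> * 1"
      by (intro mult_mono abs_sin_x_le_abs_x) auto
    finally show ?thesis
      by simp
  qed
  have "\<bar>sin (x $ j - x $ i) - sin (y $ j - y $ i)\<bar> \<le> 2 * norm (x - y)" for j
    using sin_lip[of "x $ j - x $ i" "y $ j - y $ i"]
      component_le_norm_cart[of "x - y" i] component_le_norm_cart[of "x - y" j]
    by (simp only: vector_minus_component)
  then have "\<bar>\<Sum>j\<in>UNIV. sin (x $ j - x $ i) - sin (y $ j - y $ i)\<bar> \<le> (\<Sum>j\<in>(UNIV :: 3 set). 2 * norm (x - y))"
    by (intro order_trans[OF sum_abs] sum_mono) auto
  then have "K / 3 * \<bar>\<Sum>j\<in>UNIV. sin (x $ j - x $ i) - sin (y $ j - y $ i)\<bar> \<le> K / 3 * (6 * norm (x - y))"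
    using assms by (intro mult_left_mono) auto
  moreover have "coupling K x i - coupling K y i
      = K / 3 * (\<Sum>j\<in>UNIV. sin (x $ j - x $ i) - sin (y $ j - y $ i))"
    by (simp add: coupling_def sum_subtractf right_diff_distrib)
  ultimately show ?thesis
    using assms by (simp only: abs_mult)
qed

text \<open>Some global constant is enough for the Picard argument: 1 comes from the velocity part,
  and \<open>3 * (2 * K + 1) / m\<close> from the sum norm of the three accelerations.\<close>

lemma second_order_field_lipschitz:
  assumes "m > 0" "K > 0"
  shows "norm (second_order_field m K \<Omega> p - second_order_field m K \<Omega> q)
    \<le> (1 + 3 * (2 * K + 1) / m) * norm (p - q)"
proof -
  let ?a = "\<lambda>p i. (\<Omega> $ i + coupling K (fst p) i - snd p $ i) / m"
  have pq: "p - q = (fst p - fst q, snd p - snd q)"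
    by (simp add: prod_eq_iff)
  have comp: "\<bar>?a p i - ?a q i\<bar> \<le> (2 * K + 1) / m * norm (p - q)" for i
  proof -
    have "\<bar>coupling K (fst p) i - coupling K (fst q) i\<bar> \<le> 2 * K * norm (fst p - fst q)"
      using assms by (intro abs_coupling_diff_le) auto
    also have "\<dots> \<le> 2 * K * norm (p - q)"
      unfolding pq using assms by (simp add: norm_fst_le)
    finally have "\<bar>coupling K (fst p) i - coupling K (fst q) i\<bar> \<le> 2 * K * norm (p - q)" .
    moreover have "\<bar>snd p $ i - snd q $ i\<bar> \<le> norm (p - q)"
      using component_le_norm_cart[of "snd p - snd q" i] norm_snd_le[of "snd p - snd q" "fst p - fst q"]
      unfolding pq by simp
    ultimately have "\<bar>(\<Omega> $ i + coupling K (fst p) i - snd p $ i) - (\<Omega> $ i + coupling K (fst q) i - snd q $ i)\<bar>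
        \<le> (2 * K + 1) * norm (p - q)"
      by (simp add: distrib_right)
    then show ?thesis
      using assms by (simp add: divide_right_mono flip: diff_divide_distrib)
  qed
  have "norm (second_order_field m K \<Omega> p - second_order_field m K \<Omega> q)
      = norm (snd (p - q), \<chi> i. ?a p i - ?a q i)"
    by (simp add: second_order_field_def minus_vec_def)
  also have "\<dots> \<le> norm (snd (p - q)) + norm (\<chi> i. ?a p i - ?a q i)"
    by (rule norm_Pair_le)
  also have "norm (\<chi> i. ?a p i - ?a q i) \<le> (\<Sum>i\<in>UNIV. \<bar>(\<chi> i. ?a p i - ?a q i) $ i\<bar>)"
    by (rule norm_le_l1_cart)
  also have "\<dots> \<le> (\<Sum>i\<in>(UNIV :: 3 set). (2 * K + 1) / m * norm (p - q))"
    using comp by (intro sum_mono) auto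
  also have "norm (snd (p - q)) \<le> norm (p - q)"
    unfolding pq by (simp add: norm_snd_le)
  finally show ?thesis
    by (simp add: algebra_simps)
qed

section \<open>Smoothness of trajectories\<close>

lemma has_vector_derivative_vecI:
  fixes f :: "real \<Rightarrow> real ^ 'n"
  assumes "\<And>i. ((\<lambda>t. f t $ i) has_real_derivative f' $ i) (at t within S)"
  shows "(f has_vector_derivative f') (at t within S)"
  unfolding has_vector_derivative_def
proof (subst has_derivative_componentwise_within, intro ballI)
  fix b :: "real ^ 'n" assume "b \<in> Basis"
  then obtain i where "b = axis i 1"
    by (auto simp: Basis_vec_def)
  with assms[of i] show "((\<lambda>x. f x \<bullet> b) has_derivative (\<lambda>x. (x *\<^sub>R f') \<bullet> b)) (at t within S)"
    by (simp add: inner_axis has_field_derivative_def mult_commute_abs)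
qed

text \<open>Closed under differentiation along a trajectory, which makes every member smooth.\<close>
inductive_set trajectory_algebra :: "(real \<Rightarrow> real ^ 3) \<Rightarrow> (real \<Rightarrow> real ^ 3) \<Rightarrow> (real \<Rightarrow> real) set"
  for \<theta> v where
  const: "(\<lambda>t. c) \<in> trajectory_algebra \<theta> v"
| velocity: "(\<lambda>t. v t $ i) \<in> trajectory_algebra \<theta> v"
| sin: "(\<lambda>t. sin (\<theta> t $ j - \<theta> t $ i)) \<in> trajectory_algebra \<theta> v"
| cos: "(\<lambda>t. cos (\<theta> t $ j - \<theta> t $ i)) \<in> trajectory_algebra \<theta> v"
| add: "f \<in> trajectory_algebra \<theta> v \<Longrightarrow> g \<in> trajectory_algebra \<theta> v \<Longrightarrow>
    (\<lambda>t. f t + g t) \<in> trajectory_algebra \<theta> v"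
| mult: "f \<in> trajectory_algebra \<theta> v \<Longrightarrow> g \<in> trajectory_algebra \<theta> v \<Longrightarrow>
    (\<lambda>t. f t * g t) \<in> trajectory_algebra \<theta> v"

text \<open>Differentiating a velocity would leave the algebra, but the equation of motion rewrites
  the acceleration as a polynomial in the generators; the product and chain rules do the
  rest.\<close>

lemma trajectory_algebra_deriv:
  assumes phase: "\<And>t i. t \<ge> 0 \<Longrightarrow> ((\<lambda>t. \<theta> t $ i) has_real_derivative v t $ i) (at t within {0..})"
    and velocity: "\<And>t i. t \<ge> 0 \<Longrightarrow>
      ((\<lambda>t. v t $ i) has_real_derivative (\<Omega> $ i + coupling K (\<theta> t) i - v t $ i) / m) (at t within {0..})"
    and "f \<in> trajectory_algebra \<theta> v"
  shows "\<exists>g\<in>trajectory_algebra \<theta> v. \<forall>t\<ge>0. (f has_real_derivative g t) (at t within {0..})"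
  using assms(3)
proof induction
  case (const c)
  show ?case
    by (intro bexI[of _ "\<lambda>t. 0"] trajectory_algebra.const) simp
next
  case (velocity i)
  \<comment> \<open>The acceleration written with constants, sums and products only, the shape that
    the introduction rules can build.\<close>
  have "(\<lambda>t. (1 / m) * (\<Omega> $ i + (K / 3 * (sin (\<theta> t $ 1 - \<theta> t $ i) + (sin (\<theta> t $ 2 - \<theta> t $ i)
      + sin (\<theta> t $ 3 - \<theta> t $ i))) + (-1) * v t $ i))) \<in> trajectory_algebra \<theta> v" (is "?g \<in> _")
    by (intro trajectory_algebra.intros)
  moreover have "?g = (\<lambda>t. (\<Omega> $ i + coupling K (\<theta> t) i - v t $ i) / m)"
    by (simp add: fun_eq_iff coupling_def sum_3)
  ultimately show ?case
    using assms(2)[of _ i]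
    by (intro bexI[of _ "\<lambda>t. (\<Omega> $ i + coupling K (\<theta> t) i - v t $ i) / m"]) simp_all
next
  case (sin j i)
  have "((\<lambda>t. sin (\<theta> t $ j - \<theta> t $ i)) has_real_derivative
      cos (\<theta> t $ j - \<theta> t $ i) * (v t $ j + (-1) * v t $ i)) (at t within {0..})" if "t \<ge> 0" for t
    by (rule derivative_eq_intros phase[OF that] refl)+ simp
  then show ?case
    by (intro bexI[of _ "\<lambda>t. cos (\<theta> t $ j - \<theta> t $ i) * (v t $ j + (-1) * v t $ i)"]
        trajectory_algebra.intros) blast
next
  case (cos j i)
  have "((\<lambda>t. cos (\<theta> t $ j - \<theta> t $ i)) has_real_derivative
      sin (\<theta> t $ j - \<theta> t $ i) * (v t $ i + (-1) * v t $ j)) (at t within {0..})" if "t \<ge> 0" for t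
    by (rule derivative_eq_intros phase[OF that] refl)+ (simp add: algebra_simps)
  then show ?case
    by (intro bexI[of _ "\<lambda>t. sin (\<theta> t $ j - \<theta> t $ i) * (v t $ i + (-1) * v t $ j)"]
        trajectory_algebra.intros) blast
next
  case (add f g)
  then obtain f' g' where "f' \<in> trajectory_algebra \<theta> v" "g' \<in> trajectory_algebra \<theta> v"
    "\<And>t. t \<ge> 0 \<Longrightarrow> (f has_real_derivative f' t) (at t within {0..})"
    "\<And>t. t \<ge> 0 \<Longrightarrow> (g has_real_derivative g' t) (at t within {0..})"
    by blast
  then show ?case
    by (intro bexI[of _ "\<lambda>t. f' t + g' t"] trajectory_algebra.add) (auto intro: DERIV_add)
next
  case (mult f g)
  then obtain f' g' where "f' \<in> trajectory_algebra \<theta> v" "g' \<in> trajectory_algebra \<theta> v"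
    "\<And>t. t \<ge> 0 \<Longrightarrow> (f has_real_derivative f' t) (at t within {0..})"
    "\<And>t. t \<ge> 0 \<Longrightarrow> (g has_real_derivative g' t) (at t within {0..})"
    by blast
  with mult.hyps show ?case
    by (intro bexI[of _ "\<lambda>t. f' t * g t + g' t * f t"] trajectory_algebra.add trajectory_algebra.mult)
      (auto intro: DERIV_mult)
qed

lemma trajectory_smooth:
  assumes phase: "\<And>t i. t \<ge> 0 \<Longrightarrow> ((\<lambda>t. \<theta> t $ i) has_real_derivative v t $ i) (at t within {0..})"
    and velocity: "\<And>t i. t \<ge> 0 \<Longrightarrow>
      ((\<lambda>t. v t $ i) has_real_derivative (\<Omega> $ i + coupling K (\<theta> t) i - v t $ i) / m) (at t within {0..})"
  shows "smooth_on_half_line \<theta>"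
proof -
  let ?A = "trajectory_algebra \<theta> v"
  obtain D where D: "\<And>f. f \<in> ?A \<Longrightarrow> D f \<in> ?A"
    "\<And>f t. f \<in> ?A \<Longrightarrow> t \<ge> 0 \<Longrightarrow> (f has_real_derivative D f t) (at t within {0..})"
    using trajectory_algebra_deriv[OF assms] by metis
  have mem: "(D ^^ n) (\<lambda>t. v t $ i) \<in> ?A" for n i
    by (induction n) (auto intro: D(1) trajectory_algebra.velocity)
  \<comment> \<open>The phases enter the algebra only through sines and cosines of their
    differences, so iteration of \<open>D\<close> starts at the velocity and the index is shifted by
    one.\<close>
  define d where "d k t = (case k of 0 \<Rightarrow> \<theta> t | Suc n \<Rightarrow> \<chi> i. (D ^^ n) (\<lambda>t. v t $ i) t)" for k t
  have "(d k has_vector_derivative d (Suc k) t) (at t within {0..})" if "t \<ge> 0" for k t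
  proof (rule has_vector_derivative_vecI)
    fix i
    show "((\<lambda>t. d k t $ i) has_real_derivative d (Suc k) t $ i) (at t within {0..})"
      using phase[OF that, of i] D(2)[OF mem that] by (cases k) (auto simp: d_def)
  qed
  moreover have "d 0 t = \<theta> t" for t
    by (simp add: d_def)
  ultimately show ?thesis
    unfolding smooth_on_half_line_def by blast
qed

section \<open>Synchronization\<close>

lemma lambda3_le: "lambda3 \<le> 8 / 100"
proof -
  have "0 \<le> sin (alpha3 / 16)"
    using pi_gt3 by (intro sin_ge_zero) (auto simp: alpha3_def)
  \<comment> \<open>The bound 8/90 is 8/100 divided by the factor 9/10 in \<open>lambda3\<close>;
    here \<open>alpha3 / 16\<close> is \<pi>/40.\<close>
  moreover have "sin (alpha3 / 16) \<le> 8 / 90"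
  proof -
    have "sin (alpha3 / 16) \<le> alpha3 / 16"
      by (rule sin_x_le_x) (simp add: alpha3_def)
    also have "\<dots> \<le> 8 / 90"
      using pi_approx by (simp add: alpha3_def)
    finally show ?thesis .
  qed
  moreover from \<open>0 \<le> sin (alpha3 / 16)\<close>
  have "sin (alpha3 / 16) * cos (11 * alpha3 / 16) \<le> sin (alpha3 / 16) * 1"
    by (intro mult_left_mono cos_le_one)
  ultimately show ?thesis
    by (simp add: lambda3_def)
qed

text \<open>A lower bound for the logarithm suffices: its argument is at least 75, which exceeds
  e^3. The denominator is then at least 24, and \<open>alpha3 / 24\<close> is \<pi>/60, about
  0.05236.\<close>

lemma inertia_bound:
  assumes "x \<le> alpha3 /
      (4 * (sin (alpha3 / 16) * cos (11 * alpha3 / 16) + 2) *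
       ln ((4 * sin (alpha3 / 16) * cos (11 * alpha3 / 16) + 6) /
           (sin (alpha3 / 16) * cos (11 * alpha3 / 16))))"
  shows "x \<le> 525 / 10000"
proof -
  define p where "p = sin (alpha3 / 16) * cos (11 * alpha3 / 16)"
  have s: "0 < sin (alpha3 / 16)" and c: "0 < cos (11 * alpha3 / 16)"
    using pi_gt3 by (auto intro!: sin_gt_zero cos_gt_zero simp: alpha3_def)
  then have "p > 0"
    by (simp add: p_def)
  have "sin (alpha3 / 16) \<le> alpha3 / 16"
    by (rule sin_x_le_x) (simp add: alpha3_def)
  also have "\<dots> \<le> 8 / 100"
    using pi_approx by (simp add: alpha3_def)
  finally have "p \<le> 8 / 100 * 1"
    unfolding p_def using s c by (intro mult_mono) auto
  have "exp 3 = exp (1 :: real) ^ 3"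
    by (simp flip: exp_of_nat_mult)
  also have "\<dots> \<le> (272 / 100) ^ 3"
    using e_less_272 by (intro power_mono) auto
  also have "\<dots> \<le> 75"
    by (simp add: power3_eq_cube)
  also have "75 \<le> (4 * p + 6) / p"
    using \<open>p > 0\<close> \<open>p \<le> 8 / 100 * 1\<close> by (simp add: le_divide_eq)
  finally have "3 \<le> ln ((4 * p + 6) / p)"
    using \<open>p > 0\<close> by (subst ln_ge_iff) auto
  have "x \<le> alpha3 / (4 * (p + 2) * ln ((4 * p + 6) / p))"
    using assms by (simp add: p_def mult.assoc)
  also have "\<dots> \<le> alpha3 / (4 * 2 * 3)"
    using \<open>p > 0\<close> \<open>3 \<le> ln ((4 * p + 6) / p)\<close>
    by (intro divide_left_mono mult_mono mult_pos_pos) (auto simp: alpha3_def)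
  also have "\<dots> \<le> 525 / 10000"
    using pi_approx by (simp add: alpha3_def)
  finally show ?thesis .
qed

lemma abs_diff_le_diam:
  fixes X :: "real ^ 'n"
  shows "\<bar>X $ i - X $ j\<bar> \<le> diam X"
proof -
  have "{X $ i - X $ j | i j. True} = (\<lambda>(i, j). X $ i - X $ j) ` UNIV"
    by auto
  then have "finite {X $ i - X $ j | i j. True}"
    by simp
  then have "X $ k - X $ l \<le> diam X" for k l
    unfolding diam_def by (intro Max_ge) auto
  from this[of i j] this[of j i] show ?thesis
    by simp
qed

theorem theorem1p3:
  fixes m K :: real and \<Omega> \<Theta>0 V0 :: "real ^ 3"
  assumes "m > 0" and "K > 0"
    and "m * K \<le> alpha3 /
      (4 * (sin (alpha3 / 16) * cos (11 * alpha3 / 16) + 2) *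
       ln ((4 * sin (alpha3 / 16) * cos (11 * alpha3 / 16) + 6) /
           (sin (alpha3 / 16) * cos (11 * alpha3 / 16))))"
    and "diam \<Omega> < lambda3 * K"
  shows "\<exists>\<theta> :: real \<Rightarrow> real ^ 3.
    kuramoto_ivp_solution m K \<Omega> \<Theta>0 V0 \<theta> \<and>
    smooth_on_half_line \<theta> \<and>
    (\<forall>\<phi>. kuramoto_ivp_solution m K \<Omega> \<Theta>0 V0 \<phi> \<longrightarrow> (\<forall>t\<ge>0. \<phi> t = \<theta> t)) \<and>
    (\<forall>i. ((\<lambda>t. vector_derivative \<theta> (at t) $ i) \<longlongrightarrow> mean_freq \<Omega>) at_top)"
proof -
  have small_inertia: "m * K \<le> 525 / 10000"
    using assms(3) by (rule inertia_bound)
  have small_freq: "\<bar>\<Omega> $ i - \<Omega> $ j\<bar> \<le> 8 / 100 * K" for i j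
  proof -
    have "lambda3 * K \<le> 8 / 100 * K"
      using lambda3_le \<open>K > 0\<close> by (intro mult_right_mono) auto
    with abs_diff_le_diam[of \<Omega> i j] assms(4) show ?thesis
      by linarith
  qed
  let ?F = "second_order_field m K \<Omega>" and ?L = "1 + 3 * (2 * K + 1) / m"
  have "?L > 0"
    using assms(1,2) by (simp add: add_pos_nonneg)
  note lip = second_order_field_lipschitz[OF assms(1,2)]
  \<comment> \<open>Positive times are interior to the half-line, so one-sided and two-sided
    derivatives agree there.\<close>
  have within: "at t within {0..} = at t" if "t > 0" for t :: real
    using that by (intro at_within_open_subset[of t "{0<..}"]) auto
  obtain y where y0: "y 0 = (\<Theta>0, V0)"
    and y: "\<And>t. t \<ge> 0 \<Longrightarrow> (y has_vector_derivative ?F (y t)) (at t within {0..})"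
    using global_lipschitz_ode_exists[of ?L ?F "(\<Theta>0, V0)", OF \<open>?L > 0\<close> lip] by blast
  define \<theta> v where "\<theta> t = fst (y t)" and "v t = snd (y t)" for t
  have d\<theta>: "(\<theta> has_vector_derivative v t) (at t within {0..})"
    and dv: "(v has_vector_derivative (\<chi> i. (\<Omega> $ i + coupling K (\<theta> t) i - v t $ i) / m)) (at t within {0..})"
    if "t \<ge> 0" for t
    using bounded_linear.has_vector_derivative[OF bounded_linear_fst y[OF that]]
      bounded_linear.has_vector_derivative[OF bounded_linear_snd y[OF that]]
    by (simp_all add: \<theta>_def[abs_def] v_def[abs_def] second_order_field_def)
  have phase: "((\<lambda>t. \<theta> t $ i) has_real_derivative v t $ i) (at t within {0..})"
    and velocity: "((\<lambda>t. v t $ i) has_real_derivative (\<Omega> $ i + coupling K (\<theta> t) i - v t $ i) / m) (at t within {0..})"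
    if "t \<ge> 0" for t i
    using bounded_linear.has_vector_derivative[OF bounded_linear_vec_nth[of i] d\<theta>[OF that]]
      bounded_linear.has_vector_derivative[OF bounded_linear_vec_nth[of i] dv[OF that]]
    by (simp_all add: has_real_derivative_iff_has_vector_derivative)
  have "kuramoto_ivp_solution m K \<Omega> \<Theta>0 V0 \<theta>"
    unfolding kuramoto_ivp_solution_def
  proof (intro exI[of _ v] conjI allI impI)
    show "continuous_on {0..} v"
      using dv by (auto simp: continuous_on_eq_continuous_within intro: has_vector_derivative_continuous)
    fix t :: real assume "t > 0"
    show "\<exists>a. (v has_vector_derivative a) (at t) \<and>
        (\<forall>i. m * a $ i + v t $ i = \<Omega> $ i + K / 3 * (\<Sum>j\<in>UNIV. sin (\<theta> t $ j - \<theta> t $ i)))"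
      using dv[of t] \<open>t > 0\<close> \<open>m > 0\<close>
      by (intro exI[of _ "\<chi> i. (\<Omega> $ i + coupling K (\<theta> t) i - v t $ i) / m"])
        (auto simp: within coupling_def)
  qed (use d\<theta> y0 in \<open>auto simp: \<theta>_def v_def\<close>)
  moreover have "smooth_on_half_line \<theta>"
    using phase velocity by (rule trajectory_smooth)
  moreover have "\<phi> t = \<theta> t" if sol: "kuramoto_ivp_solution m K \<Omega> \<Theta>0 V0 \<phi>" and "t \<ge> 0" for \<phi> t
  proof -
    obtain u where d\<phi>: "\<And>t. t \<ge> 0 \<Longrightarrow> (\<phi> has_vector_derivative u t) (at t within {0..})"
      and cont_u: "continuous_on {0..} u" and init: "\<phi> 0 = \<Theta>0" "u 0 = V0"
      and eq: "\<And>t. t > 0 \<Longrightarrow> \<exists>a. (u has_vector_derivative a) (at t) \<and>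
        (\<forall>i. m * a $ i + u t $ i = \<Omega> $ i + K / 3 * (\<Sum>j\<in>UNIV. sin (\<phi> t $ j - \<phi> t $ i)))"
      using sol unfolding kuramoto_ivp_solution_def by blast
    have "(\<phi> t, u t) = y t"
    proof (rule lipschitz_ode_unique[OF lip, where x = "\<lambda>t. (\<phi> t, u t)"])
      show "continuous_on {0..} (\<lambda>t. (\<phi> t, u t))"
        using d\<phi> by (intro continuous_on_Pair cont_u)
          (auto simp: continuous_on_eq_continuous_within intro: has_vector_derivative_continuous)
      show "continuous_on {0..} y"
        using y by (auto simp: continuous_on_eq_continuous_within intro: has_vector_derivative_continuous)
      show "(\<phi> 0, u 0) = y 0"
        by (simp add: init y0)
    next
      fix t :: real assume "t > 0"
      then show "(y has_vector_derivative ?F (y t)) (at t)"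
        using y[of t] by (simp add: within)
      obtain a where a: "(u has_vector_derivative a) (at t)"
        "\<And>i. m * a $ i + u t $ i = \<Omega> $ i + coupling K (\<phi> t) i"
        using eq[OF \<open>t > 0\<close>] unfolding coupling_def by blast
      \<comment> \<open>Solving for the acceleration turns an arbitrary classical solution into a
        solution of the first-order system in phase space, to which uniqueness applies.\<close>
      have "m * a $ i = \<Omega> $ i + coupling K (\<phi> t) i - u t $ i" for i
        using a(2)[of i] by simp
      then have "a = (\<chi> i. (\<Omega> $ i + coupling K (\<phi> t) i - u t $ i) / m)"
        using \<open>m > 0\<close> by (simp add: vec_eq_iff eq_divide_eq mult.commute)
      with has_vector_derivative_Pair[OF d\<phi>[of t, unfolded within[OF \<open>t > 0\<close>]] a(1)] \<open>t > 0\<close>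
      show "((\<lambda>t. (\<phi> t, u t)) has_vector_derivative ?F (\<phi> t, u t)) (at t)"
        by (simp add: second_order_field_def)
    qed (use \<open>t \<ge> 0\<close> in auto)
    then show ?thesis
      by (metis \<theta>_def fst_conv)
  qed
  moreover have "((\<lambda>t. vector_derivative \<theta> (at t) $ i) \<longlongrightarrow> mean_freq \<Omega>) at_top" for i
  proof -
    interpret kuramoto_trajectory m K \<Omega> \<theta> v
    proof (unfold_locales)
      fix t :: real and i assume "t > 0"
      then show "((\<lambda>t. \<theta> t $ i) has_real_derivative v t $ i) (at t)"
        and "((\<lambda>t. v t $ i) has_real_derivative (\<Omega> $ i + coupling K (\<theta> t) i - v t $ i) / m) (at t)"
        using phase[of t i] velocity[of t i] by (simp_all add: within)
    qed (use assms in auto)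
    have "eventually (\<lambda>t. v t $ i = vector_derivative \<theta> (at t) $ i) at_top"
      using eventually_gt_at_top[of 0]
    proof eventually_elim
      case (elim t)
      then show ?case
        using d\<theta>[of t] by (simp add: within vector_derivative_at)
    qed
    with velocity_tendsto_mean_freq[OF small_freq small_inertia] show ?thesis
      by (rule Lim_transform_eventually)
  qed
  ultimately show ?thesis
    by blast
qed

end
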